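(* Let $n \ge 1$. Every Threshold-of-ANDs circuit (with the size convention described in the context) computing the parity function $\mathrm{Par}(x_1,\ldots,x_n) = \sum_i x_i \bmod 2$ on $\{0,1\}^n$ has size at least $(3/2)^n$.
   Context: A Threshold-of-ANDs circuit on Boolean inputs $x_1,\ldots,x_n$ consists of AND gates $g_1,\ldots,g_s$, each computing the conjunction of a set of literals from $\{x_1,\ldots,x_n,\neg x_1,\ldots,\neg x_n\}$ (an AND gate with an empty set of literals computes the constant $1$), feeding a single top threshold gate with real weights $w_1,\ldots,w_s$ and no constant term: the circuit outputs $1$ if $\sum_{t} w_t g_t(x) < 0$ and $0$ if $\sum_t w_t g_t(x) > 0$, where it is required that $\sum_t w_t g_t(x) \neq 0$ for every $x \in \{0,1\}^n$. The size of the circuit is the number $s$ of AND gates. A circuit computes $f$ if its output equals $f(x)$ for all $x \in \{0,1\}^n$. *)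

theory Defs
  imports Complex_Main "HOL-Library.FuncSet"
begin

definition cube :: "nat \<Rightarrow> (nat \<Rightarrow> nat) set" where
  "cube n = {1..n} \<rightarrow>\<^sub>E {0, 1}"

definition parity_fun :: "nat \<Rightarrow> (nat \<Rightarrow> nat) \<Rightarrow> nat" where
  "parity_fun n x = (\<Sum>i=1..n. x i) mod 2"

datatype literal = Pos nat | Neg nat

definition literals :: "nat \<Rightarrow> literal set" where
  "literals n = Pos ` {1..n} \<union> Neg ` {1..n}"

fun lit_true :: "(nat \<Rightarrow> nat) \<Rightarrow> literal \<Rightarrow> bool" where
  "lit_true x (Pos i) \<longleftrightarrow> x i = 1"
| "lit_true x (Neg i) \<longleftrightarrow> x i = 0"

definition and_gate :: "literal set \<Rightarrow> (nat \<Rightarrow> nat) \<Rightarrow> real" where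
  "and_gate L x = (if \<forall>l\<in>L. lit_true x l then 1 else 0)"

text \<open>A circuit is the list of its AND gates, each given by its weight at the top gate and its
  set of literals. Being a list, it may contain the same gate several times.\<close>

type_synonym circuit = "(real \<times> literal set) list"

definition top_sum :: "circuit \<Rightarrow> (nat \<Rightarrow> nat) \<Rightarrow> real" where
  "top_sum C x = (\<Sum>(w, L)\<leftarrow>C. w * and_gate L x)"

definition threshold_of_ands :: "nat \<Rightarrow> circuit \<Rightarrow> bool" where
  "threshold_of_ands n C \<longleftrightarrow>
     (\<forall>(w, L)\<in>set C. L \<subseteq> literals n) \<and> (\<forall>x\<in>cube n. top_sum C x \<noteq> 0)"

definition circuit_size :: "circuit \<Rightarrow> nat" where
  "circuit_size C = length C"

text \<open>The output is only meaningful where the top sum is nonzero, as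
  \<^const>\<open>threshold_of_ands\<close> requires. A negative sum means output 1.\<close>

definition circuit_output :: "circuit \<Rightarrow> (nat \<Rightarrow> nat) \<Rightarrow> nat" where
  "circuit_output C x = (if top_sum C x < 0 then 1 else 0)"

definition computes :: "nat \<Rightarrow> circuit \<Rightarrow> ((nat \<Rightarrow> nat) \<Rightarrow> nat) \<Rightarrow> bool" where
  "computes n C f \<longleftrightarrow> (\<forall>x\<in>cube n. circuit_output C x = f x)"

end

theory Submission
  imports Defs
begin

text \<open>Split the AND gates according to whether they contain \<open>x\<^sub>m\<close> (sum \<open>A\<close>), its negation
  (sum \<open>B\<close>), or neither (sum \<open>D\<close>), and delete the variable \<open>x\<^sub>m\<close> from them. The top sum is
  \<open>A + D\<close> on \<open>x\<^sub>m = 1\<close> and \<open>B + D\<close> on \<open>x\<^sub>m = 0\<close>. As parity flips with \<open>x\<^sub>m\<close>, each of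
  \<open>B + D\<close>, \<open>- A - D\<close> and their sum \<open>B - A\<close> has the sign of the parity of the remaining
  variables. Every gate occurs in at most two of these three circuits, so the minimal size grows
  by a factor of at least \<open>3/2\<close> with each variable.\<close>

text \<open>\<open>T\<close> records which of the two literals on variable \<open>m\<close> a gate
  contains. A gate with both is constantly 0 and lies in none of the classes \<open>{Pos m}\<close>,
  \<open>{Neg m}\<close>, \<open>{}\<close>.\<close>

definition split_gates :: "nat \<Rightarrow> literal set \<Rightarrow> circuit \<Rightarrow> circuit" where
  "split_gates m T C =
     map (\<lambda>(w, L). (w, L - {Pos m, Neg m})) (filter (\<lambda>(w, L). L \<inter> {Pos m, Neg m} = T) C)"

definition negate_weights :: "circuit \<Rightarrow> circuit" where
  "negate_weights C = map (\<lambda>(w, L). (- w, L)) C"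

lemma top_sum_Nil: "top_sum [] x = 0"
  by (simp add: top_sum_def)

lemma top_sum_Cons: "top_sum ((w, L) # C) x = w * and_gate L x + top_sum C x"
  by (simp add: top_sum_def)

lemma top_sum_append: "top_sum (C @ D) x = top_sum C x + top_sum D x"
  by (simp add: top_sum_def)

lemma top_sum_negate_weights: "top_sum (negate_weights C) x = - top_sum C x"
  by (induction C) (auto simp: top_sum_def negate_weights_def)

lemma lit_true_fun_upd:
  "l \<noteq> Pos m \<Longrightarrow> l \<noteq> Neg m \<Longrightarrow> lit_true (x(m := b)) l \<longleftrightarrow> lit_true x l"
  by (cases l) auto

lemma and_gate_fun_upd:
  "and_gate L (x(m := b)) =
     (if (Pos m \<in> L \<longrightarrow> b = 1) \<and> (Neg m \<in> L \<longrightarrow> b = 0) then and_gate (L - {Pos m, Neg m}) x else 0)"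
proof -
  have "(\<forall>l\<in>L. lit_true (x(m := b)) l) \<longleftrightarrow>
      (Pos m \<in> L \<longrightarrow> b = 1) \<and> (Neg m \<in> L \<longrightarrow> b = 0) \<and> (\<forall>l\<in>L - {Pos m, Neg m}. lit_true x l)"
    (is "?l \<longleftrightarrow> ?r")
  proof
    assume l: ?l
    have "lit_true x l" if "l \<in> L - {Pos m, Neg m}" for l
      using l that lit_true_fun_upd[of l m x b] by blast
    moreover have "Pos m \<in> L \<longrightarrow> b = 1" "Neg m \<in> L \<longrightarrow> b = 0"
      using bspec[OF l, of "Pos m"] bspec[OF l, of "Neg m"] by simp_all
    ultimately show ?r
      by blast
  next
    assume r: ?r
    show ?l
    proof
      fix l assume "l \<in> L"
      with r show "lit_true (x(m := b)) l"
        by (cases "l \<in> {Pos m, Neg m}") (auto simp: lit_true_fun_upd)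
    qed
  qed
  then show ?thesis
    by (auto simp: and_gate_def)
qed

lemma split_gates_Cons:
  "split_gates m T ((w, L) # C) =
     (if L \<inter> {Pos m, Neg m} = T then (w, L - {Pos m, Neg m}) # split_gates m T C
      else split_gates m T C)"
  by (simp add: split_gates_def)

text \<open>Setting variable \<open>m\<close> to 1 makes every gate with \<open>Neg m\<close>
  vanish, while \<open>Pos m\<close> becomes true and can be deleted from its gates.\<close>

lemma top_sum_fun_upd_1:
  "top_sum C (x(m := 1)) = top_sum (split_gates m {Pos m} C) x + top_sum (split_gates m {} C) x"
proof (induction C)
  case Nil
  then show ?case by (simp add: top_sum_Nil split_gates_def)
next
  case (Cons a C)
  obtain w L where a: "a = (w, L)" by force
  show ?case
    unfolding a top_sum_Cons split_gates_Cons Cons.IH and_gate_fun_upd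
    by (cases "Pos m \<in> L"; cases "Neg m \<in> L")
      (simp_all add: top_sum_Cons Int_insert_right)
qed

lemma top_sum_fun_upd_0:
  "top_sum C (x(m := 0)) = top_sum (split_gates m {Neg m} C) x + top_sum (split_gates m {} C) x"
proof (induction C)
  case Nil
  then show ?case by (simp add: top_sum_Nil split_gates_def)
next
  case (Cons a C)
  obtain w L where a: "a = (w, L)" by force
  show ?case
    unfolding a top_sum_Cons split_gates_Cons Cons.IH and_gate_fun_upd
    by (cases "Pos m \<in> L"; cases "Neg m \<in> L")
      (simp_all add: top_sum_Cons Int_insert_right)
qed

text \<open>The three classes are disjoint; equality fails exactly when some gate contains both
  literals.\<close>

lemma length_split_gates_le:
  "length (split_gates m {Pos m} C) + length (split_gates m {Neg m} C)
     + length (split_gates m {} C) \<le> length C"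
proof (induction C)
  case Nil
  then show ?case by (simp add: split_gates_def)
next
  case (Cons a C)
  obtain w L where a: "a = (w, L)" by force
  show ?case using Cons unfolding a
    by (cases "Pos m \<in> L"; cases "Neg m \<in> L") (simp_all add: split_gates_Cons Int_insert_right)
qed

lemma fun_upd_mem_cube_Suc:
  "x \<in> cube n \<Longrightarrow> b \<in> {0, 1} \<Longrightarrow> x(Suc n := b) \<in> cube (Suc n)"
  by (simp add: cube_def atLeastAtMostSuc_conv PiE_fun_upd)

text \<open>The claim is phrased through the sign of the top sum because strict positivity survives
  adding two such sums, which is how the third circuit of the induction step arises.\<close>

lemma parity_sign_size_ge:
  assumes "\<forall>x\<in>cube n. (-1) ^ (\<Sum>i=1..n. x i) * top_sum C x > 0"
  shows "(3 / 2) ^ n \<le> real (length C)"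
  using assms
proof (induction n arbitrary: C)
  case 0
  \<comment> \<open>\<open>cube 0\<close> is nonempty, and at its point an empty circuit would have
    top sum 0, so there is at least one gate.\<close>
  have "(\<lambda>_. undefined) \<in> cube 0"
    by (simp add: cube_def)
  with 0 have "C \<noteq> []"
    by (auto simp: top_sum_Nil)
  then show ?case
    by (cases C) auto
next
  case (Suc n)
  let ?A = "split_gates (Suc n) {Pos (Suc n)} C"
  let ?B = "split_gates (Suc n) {Neg (Suc n)} C"
  let ?D = "split_gates (Suc n) {} C"
  have sgn0: "(-1) ^ (\<Sum>i=1..n. x i) * (top_sum ?B x + top_sum ?D x) > 0"
    and sgn1: "(-1) ^ (\<Sum>i=1..n. x i) * (- top_sum ?A x - top_sum ?D x) > 0"
    if x: "x \<in> cube n" for x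
  proof -
    have sum_eq: "(\<Sum>i=1..Suc n. (x(Suc n := b)) i) = (\<Sum>i=1..n. x i) + b" for b
      by simp
    have "(-1) ^ ((\<Sum>i=1..n. x i) + b) * top_sum C (x(Suc n := b)) > 0" if "b \<in> {0, 1}" for b
      using bspec[OF Suc.prems fun_upd_mem_cube_Suc[OF x that]] unfolding sum_eq .
    \<comment> \<open>For \<open>b = 1\<close> the exponent grows by one; the extra factor -1 is
      moved into the top sum.\<close>
    from this[of 0] this[of 1]
    show "(-1) ^ (\<Sum>i=1..n. x i) * (top_sum ?B x + top_sum ?D x) > 0"
      and "(-1) ^ (\<Sum>i=1..n. x i) * (- top_sum ?A x - top_sum ?D x) > 0"
      by (simp_all add: top_sum_fun_upd_0 top_sum_fun_upd_1[unfolded One_nat_def] algebra_simps)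
  qed
  have "(3 / 2) ^ n \<le> real (length (?B @ ?D))"
    using sgn0 by (intro Suc.IH) (auto simp: top_sum_append)
  moreover have "(3 / 2) ^ n \<le> real (length (negate_weights ?A @ negate_weights ?D))"
    using sgn1 by (intro Suc.IH) (auto simp: top_sum_append top_sum_negate_weights)
  moreover have "(3 / 2) ^ n \<le> real (length (?B @ negate_weights ?A))"
  proof (intro Suc.IH ballI)
    fix x assume "x \<in> cube n"
    \<comment> \<open>The contributions of \<open>?D\<close> cancel in this sum.\<close>
    from add_pos_pos[OF sgn0[OF this] sgn1[OF this]]
    show "(-1) ^ (\<Sum>i=1..n. x i) * top_sum (?B @ negate_weights ?A) x > 0"
      by (simp add: top_sum_append top_sum_negate_weights algebra_simps)
  qed
  \<comment> \<open>Each of the three classes occurs in two of the circuits, so adding the bounds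
    gives \<open>3 * (3/2)^n \<le> 2 * length C\<close>.\<close>
  ultimately show ?case
    using length_split_gates_le[of "Suc n" C] by (simp add: negate_weights_def)
qed

theorem theorem6p4:
  fixes n :: nat and C :: circuit
  assumes "n \<ge> 1"
    and "threshold_of_ands n C"
    and "computes n C (parity_fun n)"
  shows "real (circuit_size C) \<ge> (3 / 2) ^ n"
  unfolding circuit_size_def
proof (rule parity_sign_size_ge)
  show "\<forall>x\<in>cube n. (-1) ^ (\<Sum>i=1..n. x i) * top_sum C x > 0"
  proof
    fix x assume "x \<in> cube n"
    then have nonzero: "top_sum C x \<noteq> 0" and out: "circuit_output C x = parity_fun n x"
      using assms(2,3) by (simp_all add: threshold_of_ands_def computes_def)
    define k where "k = (\<Sum>i=1..n. x i)"
    \<comment> \<open>Output 1 means a negative sum, so the sign of the top sum is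
      \<open>(-1) ^ k\<close>.\<close>
    have neg_iff: "top_sum C x < 0 \<longleftrightarrow> odd k"
      using out unfolding circuit_output_def parity_fun_def k_def[symmetric]
      by (cases "top_sum C x < 0") (simp_all add: even_iff_mod_2_eq_zero)
    have "(-1) ^ k * top_sum C x > 0"
    proof (cases "even k")
      case True
      then show ?thesis
        using nonzero neg_iff by simp
    next
      case False
      then show ?thesis
        using neg_iff by simp
    qed
    then show "(-1) ^ (\<Sum>i=1..n. x i) * top_sum C x > 0"
      unfolding k_def .
  qed
qed

end
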